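(* Let $\mathcal D=[\mathring u_{\min},\mathring u_{\max}]$ and consider the blended point-value scheme $$u_j^{n+1}=u_j^n-2\lambda\big(\overrightarrow\Phi_{j-1/2}+\overleftarrow\Phi_{j+1/2}\big),$$ $$\overrightarrow\Phi_{j-1/2}=\overrightarrow\Phi_{j-1/2}^{LO}+\theta_{j-1/2}\,\Delta\overrightarrow\Phi_{j-1/2},\qquad \overleftarrow\Phi_{j+1/2}=\overleftarrow\Phi_{j+1/2}^{LO}+\theta_{j+1/2}\,\Delta\overleftarrow\Phi_{j+1/2},$$ rewritten as a convex combination of quantities at the previous time step as in the context, with all quantities defined there. If we set $$\theta_{j-1/2}=\min\Big(1,\ \frac{\beta_{j-1/2}}{|\Delta\overrightarrow\Phi_{j-1/2}|}\min\big(u_j^{*,L}-\mathring u_{\min},\ \mathring u_{\max}-u_j^{*,L}\big)\Big)$$ and $$\theta_{j+1/2}=\min\Big(1,\ \frac{\beta_{j+1/2}}{|\Delta\overleftarrow\Phi_{j+1/2}|}\min\big(u_j^{*,R}-\mathring u_{\min},\ \mathring u_{\max}-u_j^{*,R}\big)\Big)$$ (each equal to $1$ when $\Delta\overrightarrow\Phi_{j-1/2}$, respectively $\Delta\overleftarrow\Phi_{j+1/2}$, vanishes), then the scheme has the following bound-preserving property: if $u_j^n\in\mathcal D$, then $u_j^{n+1}\in\mathcal D$, for any $n$ and any $j$.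
   Context: The scheme approximates the scalar conservation law $u_t+f(u)_x=0$, with flux function $f$, on a uniform mesh with nodes $x_j$, cells $[x_j,x_{j+1}]$ and cell size $\Delta x>0$. The time step is $\Delta t^n=t^{n+1}-t^n>0$ and $\lambda=\Delta t^n/\Delta x$. At time $t^n$ the data are cell averages $\bar u_{j+1/2}^n\in\mathbb R$ (on $[x_j,x_{j+1}]$) and point values $u_j^n\in\mathbb R$ (at $x_j$). The interval $\mathcal D$ is the invariant domain, an interval containing the values of the initial datum. For the update of $u_j$, set $$\beta_{j-1/2}=\max\big(|f'(u_j^n)|,|f'(\bar u_{j-1/2}^n)|\big),\qquad \beta_{j+1/2}=\max\big(|f'(u_j^n)|,|f'(\bar u_{j+1/2}^n)|\big).$$ Low-order residuals: $$\overrightarrow\Phi_{j-1/2}^{LO}=\frac{f(u_j^n)-f(\bar u_{j-1/2}^n)}{2}-\frac{\beta_{j-1/2}}{2}\big(\bar u_{j-1/2}^n-u_j^n\big),$$ $$\overleftarrow\Phi_{j+1/2}^{LO}=\frac{f(\bar u_{j+1/2}^n)-f(u_j^n)}{2}-\frac{\beta_{j+1/2}}{2}\big(\bar u_{j+1/2}^n-u_j^n\big).$$ High-order residuals, with $a_j=f'(u_j^n)$, $a_j^+=\max(a_j,0)$, $a_j^-=\min(a_j,0)$: $$\overrightarrow\Phi_{j-1/2}^{HO}=a_j^+\big(u_{j-1}^n-3\bar u_{j-1/2}^n+2u_j^n\big),\qquad \overleftarrow\Phi_{j+1/2}^{HO}=a_j^-\big(-2u_j^n+3\bar u_{j+1/2}^n-u_{j+1}^n\big).$$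 Differences: $\Delta\overrightarrow\Phi_{j-1/2}=\overrightarrow\Phi_{j-1/2}^{HO}-\overrightarrow\Phi_{j-1/2}^{LO}$ and $\Delta\overleftarrow\Phi_{j+1/2}=\overleftarrow\Phi_{j+1/2}^{HO}-\overleftarrow\Phi_{j+1/2}^{LO}$. Intermediate states: $$u_j^{*,L}=\frac{\bar u_{j-1/2}^n+u_j^n}{2}-\frac{f(u_j^n)-f(\bar u_{j-1/2}^n)}{2\beta_{j-1/2}},\qquad u_j^{*,R}=\frac{u_j^n+\bar u_{j+1/2}^n}{2}-\frac{f(\bar u_{j+1/2}^n)-f(u_j^n)}{2\beta_{j+1/2}}.$$ The scheme is rewritten as the convex combination $$u_j^{n+1}=\big(1-2\lambda\beta_{j-1/2}-2\lambda\beta_{j+1/2}\big)u_j^n+2\lambda\beta_{j-1/2}\Big(u_j^{*,L}-\theta_{j-1/2}\frac{\Delta\overrightarrow\Phi_{j-1/2}}{\beta_{j-1/2}}\Big)+2\lambda\beta_{j+1/2}\Big(u_j^{*,R}-\theta_{j+1/2}\frac{\Delta\overleftarrow\Phi_{j+1/2}}{\beta_{j+1/2}}\Big).$$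
   Formalization: Added hypotheses, without which the claim fails: the two adjacent cell averages also lie in D, the coefficient 1−2λβ_{j−1/2}−2λβ_{j+1/2} is nonnegative, and each β bounds the secant speed of f between u_j and the adjacent average (automatic for convex or concave f). *)

theory Defs
  imports "HOL-Analysis.Analysis"
begin

(* Data at one time level: u j is the point value at the node x_j, and ub j is the average over
   the cell [x_j, x_{j+1}], written with index j+1/2 on paper.  The cells adjacent to x_j are thus
   ub (j - 1) on its left and ub j on its right.  The suffixes L and R refer to these two cells
   in the update of u j: betaL, PhiL, ... carry the index j-1/2 and betaR, PhiR, ... the
   index j+1/2.  The number betaR at j need not equal betaL at j + 1. *)

definition betaL :: "(real \<Rightarrow> real) \<Rightarrow> (int \<Rightarrow> real) \<Rightarrow> (int \<Rightarrow> real) \<Rightarrow> int \<Rightarrow> real" where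
  "betaL f u ub j = max \<bar>deriv f (u j)\<bar> \<bar>deriv f (ub (j - 1))\<bar>"

definition betaR :: "(real \<Rightarrow> real) \<Rightarrow> (int \<Rightarrow> real) \<Rightarrow> (int \<Rightarrow> real) \<Rightarrow> int \<Rightarrow> real" where
  "betaR f u ub j = max \<bar>deriv f (u j)\<bar> \<bar>deriv f (ub j)\<bar>"

definition PhiL_LO :: "(real \<Rightarrow> real) \<Rightarrow> (int \<Rightarrow> real) \<Rightarrow> (int \<Rightarrow> real) \<Rightarrow> int \<Rightarrow> real" where
  "PhiL_LO f u ub j =
     (f (u j) - f (ub (j - 1))) / 2 - betaL f u ub j / 2 * (ub (j - 1) - u j)"

definition PhiR_LO :: "(real \<Rightarrow> real) \<Rightarrow> (int \<Rightarrow> real) \<Rightarrow> (int \<Rightarrow> real) \<Rightarrow> int \<Rightarrow> real" where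
  "PhiR_LO f u ub j =
     (f (ub j) - f (u j)) / 2 - betaR f u ub j / 2 * (ub j - u j)"

definition PhiL_HO :: "(real \<Rightarrow> real) \<Rightarrow> (int \<Rightarrow> real) \<Rightarrow> (int \<Rightarrow> real) \<Rightarrow> int \<Rightarrow> real" where
  "PhiL_HO f u ub j = max (deriv f (u j)) 0 * (u (j - 1) - 3 * ub (j - 1) + 2 * u j)"

definition PhiR_HO :: "(real \<Rightarrow> real) \<Rightarrow> (int \<Rightarrow> real) \<Rightarrow> (int \<Rightarrow> real) \<Rightarrow> int \<Rightarrow> real" where
  "PhiR_HO f u ub j = min (deriv f (u j)) 0 * (- 2 * u j + 3 * ub j - u (j + 1))"

definition DPhiL :: "(real \<Rightarrow> real) \<Rightarrow> (int \<Rightarrow> real) \<Rightarrow> (int \<Rightarrow> real) \<Rightarrow> int \<Rightarrow> real" where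
  "DPhiL f u ub j = PhiL_HO f u ub j - PhiL_LO f u ub j"

definition DPhiR :: "(real \<Rightarrow> real) \<Rightarrow> (int \<Rightarrow> real) \<Rightarrow> (int \<Rightarrow> real) \<Rightarrow> int \<Rightarrow> real" where
  "DPhiR f u ub j = PhiR_HO f u ub j - PhiR_LO f u ub j"

(* For betaL = 0 (or betaR = 0) the totalized division makes the intermediate state the mean of
   the two values. *)

definition ustarL :: "(real \<Rightarrow> real) \<Rightarrow> (int \<Rightarrow> real) \<Rightarrow> (int \<Rightarrow> real) \<Rightarrow> int \<Rightarrow> real" where
  "ustarL f u ub j =
     (ub (j - 1) + u j) / 2 - (f (u j) - f (ub (j - 1))) / (2 * betaL f u ub j)"

definition ustarR :: "(real \<Rightarrow> real) \<Rightarrow> (int \<Rightarrow> real) \<Rightarrow> (int \<Rightarrow> real) \<Rightarrow> int \<Rightarrow> real" where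
  "ustarR f u ub j =
     (u j + ub j) / 2 - (f (ub j) - f (u j)) / (2 * betaR f u ub j)"

definition thetaL ::
  "real \<Rightarrow> real \<Rightarrow> (real \<Rightarrow> real) \<Rightarrow> (int \<Rightarrow> real) \<Rightarrow> (int \<Rightarrow> real) \<Rightarrow> int \<Rightarrow> real" where
  "thetaL umin umax f u ub j =
     (if DPhiL f u ub j = 0 then 1
      else min 1 (betaL f u ub j / \<bar>DPhiL f u ub j\<bar>
                  * min (ustarL f u ub j - umin) (umax - ustarL f u ub j)))"

definition thetaR ::
  "real \<Rightarrow> real \<Rightarrow> (real \<Rightarrow> real) \<Rightarrow> (int \<Rightarrow> real) \<Rightarrow> (int \<Rightarrow> real) \<Rightarrow> int \<Rightarrow> real" where
  "thetaR umin umax f u ub j =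
     (if DPhiR f u ub j = 0 then 1
      else min 1 (betaR f u ub j / \<bar>DPhiR f u ub j\<bar>
                  * min (ustarR f u ub j - umin) (umax - ustarR f u ub j)))"

definition PhiL ::
  "real \<Rightarrow> real \<Rightarrow> (real \<Rightarrow> real) \<Rightarrow> (int \<Rightarrow> real) \<Rightarrow> (int \<Rightarrow> real) \<Rightarrow> int \<Rightarrow> real" where
  "PhiL umin umax f u ub j = PhiL_LO f u ub j + thetaL umin umax f u ub j * DPhiL f u ub j"

definition PhiR ::
  "real \<Rightarrow> real \<Rightarrow> (real \<Rightarrow> real) \<Rightarrow> (int \<Rightarrow> real) \<Rightarrow> (int \<Rightarrow> real) \<Rightarrow> int \<Rightarrow> real" where
  "PhiR umin umax f u ub j = PhiR_LO f u ub j + thetaR umin umax f u ub j * DPhiR f u ub j"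

end

theory Submission
  imports Defs
begin

text \<open>
  Fix one side of the node, with point value \<open>w\<close>, neighbouring cell average \<open>v\<close>, speed \<open>\<beta>\<close> and
  intermediate state \<open>s\<close>.  The low-order residual is exactly \<open>\<beta> (w - s)\<close>, so the blended residual
  is \<open>\<Phi> = \<beta> w - (\<beta> s - \<theta> d)\<close>: up to the factor \<open>\<beta>\<close>, it measures how far \<open>w\<close> is from the
  limited state \<open>s - \<theta> d / \<beta>\<close>.  Because \<open>\<beta>\<close> dominates the secant slope of the flux, \<open>s\<close>
  is a weighted mean of \<open>v\<close> and \<open>w\<close> (\<open>intermediate_state_bounds\<close>), hence lies in the invariant
  interval; the blending coefficient is chosen so that \<open>\<bar>\<theta> d\<bar>\<close> is at most \<open>\<beta>\<close> times the distance
  from \<open>s\<close> to the boundary of that interval (\<open>limited_correction_bound\<close>), so the limited state does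
  not leave it.

  All of this is recorded in the division-free form \<open>\<beta> (m - w) \<le> -\<Phi> \<le> \<beta> (M - w)\<close>
  (\<open>blended_residual_bounds\<close>).  This form covers \<open>\<beta> = 0\<close> as well: there the convex combination of
  limited states has no meaning, but the blended residual vanishes.  Adding the two sides gives
  \<open>w + c (m - w) \<le> w - 2 \<lambda> (\<Phi>\<^sub>L + \<Phi>\<^sub>R) \<le> w + c (M - w)\<close> with
  \<open>c = 2 \<lambda> (\<beta>\<^sub>L + \<beta>\<^sub>R)\<close>, and the step-size condition \<open>0 \<le> c \<le> 1\<close> makes both outer terms convex
  combinations of points of the interval.
\<close>

text \<open>
  The flux term moves the midpoint of \<open>v\<close> and \<open>w\<close> by at most half their distance, so the
  intermediate state stays between them.
\<close>

lemma intermediate_state_bounds: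
  fixes v w g \<beta> m M :: real
  assumes \<beta>: "0 < \<beta>" and g: "\<bar>g\<bar> \<le> \<beta> * \<bar>v - w\<bar>"
    and v: "v \<in> {m..M}" and w: "w \<in> {m..M}"
  shows "(v + w) / 2 - g / (2 * \<beta>) \<in> {m..M}"
proof -
  define q where "q = g / \<beta>"
  have "\<bar>q\<bar> \<le> \<bar>v - w\<bar>"
    using \<beta> g by (simp add: q_def abs_divide pos_divide_le_eq mult.commute)
  then have "q \<le> \<bar>v - w\<bar>" and "- q \<le> \<bar>v - w\<bar>"
    by linarith+
  then have "(v + w) / 2 - q / 2 \<in> {m..M}"
    using v w by (cases "v \<le> w") (auto simp: field_simps)
  then show ?thesis
    by (simp add: q_def mult.commute)
qed

lemma limited_correction_bound:
  fixes d \<beta> r \<theta> :: real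
  assumes \<beta>: "0 \<le> \<beta>" and r: "0 \<le> r"
    and \<theta>: "\<theta> = (if d = 0 then 1 else min 1 (\<beta> / \<bar>d\<bar> * r))"
  shows "\<bar>\<theta> * d\<bar> \<le> \<beta> * r"
proof (cases "d = 0")
  case True
  then show ?thesis using \<beta> r by simp
next
  case False
  have "0 \<le> \<theta>" and "\<theta> \<le> \<beta> / \<bar>d\<bar> * r"
    using False \<beta> r \<theta> by auto
  then have "\<bar>\<theta> * d\<bar> \<le> \<beta> / \<bar>d\<bar> * r * \<bar>d\<bar>"
    using mult_right_mono[of \<theta> "\<beta> / \<bar>d\<bar> * r" "\<bar>d\<bar>"]
    by (simp only: abs_mult abs_of_nonneg abs_ge_zero)
  then show ?thesis using False by simp
qed

text \<open>
  Both sides of the node are instances of this lemma: \<open>g\<close> is the flux of the right state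
  minus that of the left state, among the point value and the cell average.  Only its absolute value is constrained, so it
  does not matter on which side the cell lies.  The last assumption is what remains of the relation between
  the speed and the high-order residual when the speed degenerates to zero.
\<close>

lemma blended_residual_bounds:
  fixes v w g \<beta> d s \<theta> m M :: real
  assumes \<beta>: "0 \<le> \<beta>" and g: "\<bar>g\<bar> \<le> \<beta> * \<bar>v - w\<bar>"
    and v: "v \<in> {m..M}" and w: "w \<in> {m..M}"
    and s: "s = (v + w) / 2 - g / (2 * \<beta>)"
    and \<theta>: "\<theta> = (if d = 0 then 1 else min 1 (\<beta> / \<bar>d\<bar> * min (s - m) (M - s)))"
    and degenerate: "\<beta> = 0 \<Longrightarrow> d = 0"
  shows "\<beta> * (m - w) \<le> - (g / 2 - \<beta> / 2 * (v - w) + \<theta> * d)" (is ?lower)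
    and "- (g / 2 - \<beta> / 2 * (v - w) + \<theta> * d) \<le> \<beta> * (M - w)" (is ?upper)
proof -
  have "?lower \<and> ?upper"
  proof (cases "\<beta> = 0")
    case True
    then show ?thesis using g degenerate by simp
  next
    case False
    then have pos: "0 < \<beta>" using \<beta> by simp
    have "s \<in> {m..M}"
      using intermediate_state_bounds[OF pos g v w] s by simp
    then have "\<bar>\<theta> * d\<bar> \<le> \<beta> * min (s - m) (M - s)"
      using limited_correction_bound[OF \<beta> _ \<theta>] by simp
    moreover have "\<beta> * min (s - m) (M - s) \<le> \<beta> * (s - m)"
      and "\<beta> * min (s - m) (M - s) \<le> \<beta> * (M - s)"
      using \<beta> by (simp_all add: mult_left_mono)
    moreover have "g / 2 - \<beta> / 2 * (v - w) = \<beta> * (w - s)"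
      using pos s by (simp add: field_simps)
    ultimately show ?thesis
      by (auto simp: right_diff_distrib abs_le_iff)
  qed
  then show ?lower ?upper
    by auto
qed

text \<open>
  A vanishing speed forces \<open>f' (u j) = 0\<close>, which is a factor of the high-order residual, and
  equal fluxes, which make the low-order residual vanish too.
\<close>

lemma DPhiL_eq_0_if_betaL_eq_0:
  assumes "betaL f u ub j = 0"
    and "\<bar>f (u j) - f (ub (j - 1))\<bar> \<le> betaL f u ub j * \<bar>u j - ub (j - 1)\<bar>"
  shows "DPhiL f u ub j = 0"
proof -
  have "deriv f (u j) = 0"
    using assms(1) unfolding betaL_def by linarith
  then show ?thesis
    using assms by (simp add: DPhiL_def PhiL_HO_def PhiL_LO_def)
qed

lemma DPhiR_eq_0_if_betaR_eq_0:
  assumes "betaR f u ub j = 0"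
    and "\<bar>f (ub j) - f (u j)\<bar> \<le> betaR f u ub j * \<bar>ub j - u j\<bar>"
  shows "DPhiR f u ub j = 0"
proof -
  have "deriv f (u j) = 0"
    using assms(1) unfolding betaR_def by linarith
  then show ?thesis
    using assms by (simp add: DPhiR_def PhiR_HO_def PhiR_LO_def)
qed

lemma PhiL_bounds:
  assumes speed: "\<bar>f (u j) - f (ub (j - 1))\<bar> \<le> betaL f u ub j * \<bar>u j - ub (j - 1)\<bar>"
    and "u j \<in> {m..M}" "ub (j - 1) \<in> {m..M}"
  shows "betaL f u ub j * (m - u j) \<le> - PhiL m M f u ub j"
    and "- PhiL m M f u ub j \<le> betaL f u ub j * (M - u j)"
proof -
  have "0 \<le> betaL f u ub j"
    unfolding betaL_def by linarith
  moreover have "\<bar>f (u j) - f (ub (j - 1))\<bar> \<le> betaL f u ub j * \<bar>ub (j - 1) - u j\<bar>"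
    using speed by (simp add: abs_minus_commute)
  ultimately show "betaL f u ub j * (m - u j) \<le> - PhiL m M f u ub j"
    and "- PhiL m M f u ub j \<le> betaL f u ub j * (M - u j)"
    unfolding PhiL_def PhiL_LO_def
    using blended_residual_bounds[OF _ _ assms(3,2) ustarL_def thetaL_def
        DPhiL_eq_0_if_betaL_eq_0[OF _ speed]]
    by blast+
qed

lemma PhiR_bounds:
  assumes speed: "\<bar>f (ub j) - f (u j)\<bar> \<le> betaR f u ub j * \<bar>ub j - u j\<bar>"
    and "u j \<in> {m..M}" "ub j \<in> {m..M}"
  shows "betaR f u ub j * (m - u j) \<le> - PhiR m M f u ub j"
    and "- PhiR m M f u ub j \<le> betaR f u ub j * (M - u j)"
proof -
  have "0 \<le> betaR f u ub j"
    unfolding betaR_def by linarith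
  moreover have "ustarR f u ub j = (ub j + u j) / 2 - (f (ub j) - f (u j)) / (2 * betaR f u ub j)"
    by (simp add: ustarR_def add.commute)
  ultimately show "betaR f u ub j * (m - u j) \<le> - PhiR m M f u ub j"
    and "- PhiR m M f u ub j \<le> betaR f u ub j * (M - u j)"
    unfolding PhiR_def PhiR_LO_def
    using blended_residual_bounds[OF _ speed assms(3,2) _ thetaR_def
        DPhiR_eq_0_if_betaR_eq_0[OF _ speed]]
    by blast+
qed

text \<open>
  With \<open>c = k (b + b')\<close>, the increment \<open>k (p + q)\<close> lies between \<open>c (m - w)\<close> and \<open>c (M - w)\<close>, and
  \<open>(1 - c) (w - m) \<ge> 0\<close> and \<open>(1 - c) (M - w) \<ge> 0\<close> are what is left.
\<close>

lemma convex_update_bounds: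
  fixes w p q b b' k m M :: real
  assumes "0 \<le> k" and "k * (b + b') \<le> 1" and "w \<in> {m..M}"
    and p: "b * (m - w) \<le> p" "p \<le> b * (M - w)"
    and q: "b' * (m - w) \<le> q" "q \<le> b' * (M - w)"
  shows "w + k * (p + q) \<in> {m..M}"
proof -
  have "0 \<le> (1 - k * (b + b')) * (w - m)" "0 \<le> (1 - k * (b + b')) * (M - w)"
    using assms(2,3) by simp_all
  moreover have "k * (b * (m - w) + b' * (m - w)) \<le> k * (p + q)"
    and "k * (p + q) \<le> k * (b * (M - w) + b' * (M - w))"
    using p q \<open>0 \<le> k\<close> by (simp_all add: add_mono mult_left_mono)
  ultimately show ?thesis
    by (simp add: algebra_simps)
qed

theorem proposition3p2:
  fixes f :: "real \<Rightarrow> real"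
    and umin umax dx :: real
    and t lam :: "nat \<Rightarrow> real"
    and u ub :: "nat \<Rightarrow> int \<Rightarrow> real"
    and n :: nat and j :: int
  assumes flux: "\<And>v. f differentiable (at v)"
    and mesh: "0 < dx"
    and time: "\<And>n. t n < t (Suc n)"
    and lam: "\<And>n. lam n = (t (Suc n) - t n) / dx"
    and scheme: "\<And>n j. u (Suc n) j =
          u n j - 2 * lam n * (PhiL umin umax f (u n) (ub n) j + PhiR umin umax f (u n) (ub n) j)"
    and convex_combination:
          "0 \<le> 1 - 2 * lam n * betaL f (u n) (ub n) j - 2 * lam n * betaR f (u n) (ub n) j"
    and speedL: "\<bar>f (u n j) - f (ub n (j - 1))\<bar> \<le> betaL f (u n) (ub n) j * \<bar>u n j - ub n (j - 1)\<bar>"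
    and speedR: "\<bar>f (ub n j) - f (u n j)\<bar> \<le> betaR f (u n) (ub n) j * \<bar>ub n j - u n j\<bar>"
    and data: "u n j \<in> {umin..umax}" "ub n (j - 1) \<in> {umin..umax}" "ub n j \<in> {umin..umax}"
  shows "u (Suc n) j \<in> {umin..umax}"
proof -
  have pos: "0 \<le> 2 * lam n"
    using mesh time[of n] lam[of n] by simp
  have step: "2 * lam n * (betaL f (u n) (ub n) j + betaR f (u n) (ub n) j) \<le> 1"
    using convex_combination by (simp add: distrib_left)
  have "u n j + 2 * lam n * (- PhiL umin umax f (u n) (ub n) j + - PhiR umin umax f (u n) (ub n) j)
      \<in> {umin..umax}"
    by (rule convex_update_bounds[OF pos step data(1) PhiL_bounds[OF speedL data(1,2)]
          PhiR_bounds[OF speedR data(1,3)]])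
  then show ?thesis
    by (simp add: scheme algebra_simps)
qed

end
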